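(* Let $V=(V_t)_{t\ge 0}$ be an $\mathbb{R}^d$-valued progressively measurable process, regular enough that $\phi^u_t$ is measurable for all $u\in S^{d-1}$, $t>0$. Fix some $t_r,t_s\in(0,\infty)$ and $q_s\in(0,1)$ such that $C_T$ is well defined on $S^{d-1}$, and assume that $\mathbb{P}(\phi^u_t=b)=0$ for every $u\in S^{d-1}$, $t>0$ and $b\in\mathbb{R}\cup\{\pm\infty\}$. Then $C_Q$ and $C_T$ are bounded from above on $S^{d-1}$.
   Context: Fix $d\ge1$, $S^{d-1}=\{v\in\mathbb{R}^d:\|v\|=1\}$ (Euclidean norm, inner product $\langle\cdot,\cdot\rangle$). For $u\in S^{d-1}$, $b\in\mathbb{R}$, let $\Pi^+(u,b)=\{v\in\mathbb{R}^d:\langle u,v\rangle\ge b\}$. For a set $A\subseteq\mathbb{R}^d$ the hitting time is $\tau_A=\inf\{t\ge0:V_t\in A\}$, with $\inf\emptyset=+\infty$; hitting times are taken to be random variables. $\phi^u_t=\sup_{s\in[0,t]}\langle V_s,u\rangle$ (extended-real-valued). The regularity making $\phi^u_t$ measurable is not further specified; for instance càdlàg paths, or a discrete model for $V$, may be assumed. Define $$C_Q(u)=\inf\{b\in\mathbb{R}:\mathbb{P}(\tau_{\Pi^+(u,b)}>t_s)=q_s\},\qquad C_T(u)=\inf\{b\in\mathbb{R}:\mathbb{E}[\tau_{\Pi^+(u,b)}]=t_r\};$$ such a value is called well defined if the set over which the infimum is taken is nonempty and the infimum is finite.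
   Formalization: Without path regularity the set defining C_Q(u) can be empty, so C_Q is shown bounded above only on the directions where it is well defined; on all of S^{d-1} this is shown for almost surely right-continuous paths (for instance càdlàg). *)

theory Defs
  imports "HOL-Probability.Probability"
begin

text \<open>Time is the half-line of nonnegative reals, rendered as type \<^typ>\<open>real\<close> with explicit
  guards; values of processes at negative times are never used. The filtrations of the library
  are indexed by all of \<^typ>\<open>real\<close>; one indexed by \<open>t \<ge> 0\<close> extends by \<open>F (max 0 t)\<close>.\<close>

definition progressively_measurable ::
  "(real \<Rightarrow> 'w measure) \<Rightarrow> (real \<Rightarrow> 'w \<Rightarrow> 'b::topological_space) \<Rightarrow> bool" where
  "progressively_measurable F V \<longleftrightarrow>
    (\<forall>t\<ge>0. (\<lambda>(s, \<omega>). V s \<omega>) \<in> borel_measurable (restrict_space borel {0..t} \<Otimes>\<^sub>M F t))"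

definition upper_halfspace :: "real ^ 'd \<Rightarrow> real \<Rightarrow> (real ^ 'd) set" where
  "upper_halfspace u b = {v. u \<bullet> v \<ge> b}"

text \<open>In \<^typ>\<open>ennreal\<close> the infimum of the empty set is \<open>\<infinity>\<close>.\<close>

definition hitting_time :: "(real \<Rightarrow> 'w \<Rightarrow> 'b) \<Rightarrow> 'b set \<Rightarrow> 'w \<Rightarrow> ennreal" where
  "hitting_time V A \<omega> = (INF t \<in> {t. t \<ge> 0 \<and> V t \<omega> \<in> A}. ennreal t)"

definition running_sup :: "(real \<Rightarrow> 'w \<Rightarrow> real ^ 'd) \<Rightarrow> real ^ 'd \<Rightarrow> real \<Rightarrow> 'w \<Rightarrow> ereal" where
  "running_sup V u t \<omega> = (SUP s \<in> {0..t}. ereal (V s \<omega> \<bullet> u))"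

definition C_Q_levels ::
  "'w measure \<Rightarrow> (real \<Rightarrow> 'w \<Rightarrow> real ^ 'd) \<Rightarrow> real \<Rightarrow> real \<Rightarrow> real ^ 'd \<Rightarrow> real set" where
  "C_Q_levels M V ts qs u =
    {b. measure M {\<omega> \<in> space M. hitting_time V (upper_halfspace u b) \<omega> > ennreal ts} = qs}"

definition C_T_levels ::
  "'w measure \<Rightarrow> (real \<Rightarrow> 'w \<Rightarrow> real ^ 'd) \<Rightarrow> real \<Rightarrow> real ^ 'd \<Rightarrow> real set" where
  "C_T_levels M V tr u =
    {b. (\<integral>\<^sup>+ \<omega>. hitting_time V (upper_halfspace u b) \<omega> \<partial>M) = ennreal tr}"

text \<open>The infima are taken in \<^typ>\<open>ereal\<close>: the value is \<open>\<infinity>\<close> on the empty set and \<open>-\<infinity>\<close> on a set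
  that is not bounded below.\<close>

definition C_Q ::
  "'w measure \<Rightarrow> (real \<Rightarrow> 'w \<Rightarrow> real ^ 'd) \<Rightarrow> real \<Rightarrow> real \<Rightarrow> real ^ 'd \<Rightarrow> ereal" where
  "C_Q M V ts qs u = Inf (ereal ` C_Q_levels M V ts qs u)"

definition C_T ::
  "'w measure \<Rightarrow> (real \<Rightarrow> 'w \<Rightarrow> real ^ 'd) \<Rightarrow> real \<Rightarrow> real ^ 'd \<Rightarrow> ereal" where
  "C_T M V tr u = Inf (ereal ` C_T_levels M V tr u)"

definition C_Q_well_defined ::
  "'w measure \<Rightarrow> (real \<Rightarrow> 'w \<Rightarrow> real ^ 'd) \<Rightarrow> real \<Rightarrow> real \<Rightarrow> real ^ 'd \<Rightarrow> bool" where
  "C_Q_well_defined M V ts qs u \<longleftrightarrow>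
    C_Q_levels M V ts qs u \<noteq> {} \<and> \<bar>C_Q M V ts qs u\<bar> \<noteq> \<infinity>"

definition C_T_well_defined ::
  "'w measure \<Rightarrow> (real \<Rightarrow> 'w \<Rightarrow> real ^ 'd) \<Rightarrow> real \<Rightarrow> real ^ 'd \<Rightarrow> bool" where
  "C_T_well_defined M V tr u \<longleftrightarrow>
    C_T_levels M V tr u \<noteq> {} \<and> \<bar>C_T M V tr u\<bar> \<noteq> \<infinity>"

text \<open>The bound is a real number, so a function attaining \<open>\<infinity>\<close> on \<open>S\<close> is not bounded from above.\<close>

definition bounded_from_above_on :: "'b set \<Rightarrow> ('b \<Rightarrow> ereal) \<Rightarrow> bool" where
  "bounded_from_above_on S f \<longleftrightarrow> (\<exists>B::real. \<forall>u\<in>S. f u \<le> ereal B)"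

text \<open>Cadlag processes, and discrete models embedded as step processes that are constant on
  the intervals between consecutive time points (left endpoint included), have this property.
  It makes hitting times of closed sets attained whenever they are finite. Without it
  \<^const>\<open>C_Q_levels\<close> can be empty: a jump immediately after time \<open>ts\<close> may make
  the survival probability at \<open>ts\<close> skip the value \<open>qs\<close>.\<close>

definition right_continuous_paths ::
  "'w measure \<Rightarrow> (real \<Rightarrow> 'w \<Rightarrow> 'b::topological_space) \<Rightarrow> bool" where
  "right_continuous_paths M V \<longleftrightarrow>
    (AE \<omega> in M. \<forall>t\<ge>0. continuous (at_right t) (\<lambda>s. V s \<omega>))"

end

theory Submission
  imports Defs
begin

text \<open>No atom at \<open>\<infinity>\<close> in the finitely many directions \<open>\<plusminus>e\<^sub>i\<close> makes \<open>V\<close> almost surely bounded on each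
  interval \<open>[0, T]\<close>. Hence for some \<open>B\<close> that does not depend on \<open>u\<close>, every half-space at a level
  \<open>b \<ge> B\<close> is reached only after time \<open>T\<close>, with probability as close to \<open>1\<close> as desired. For
  suitable \<open>T\<close>, the survival probability and the expectation of the hitting time at such levels
  then exceed \<open>q\<^sub>s\<close> and \<open>t\<^sub>r\<close>, so that every solution lies below \<open>B\<close>. For right-continuous paths, the survival probability at time \<open>t\<^sub>s\<close> is
  the distribution function of the running supremum, which is continuous because there are no
  atoms, so \<open>q\<^sub>s\<close> is attained.\<close>

lemma hitting_time_geI:
  assumes "\<And>s. 0 \<le> s \<Longrightarrow> s \<le> T \<Longrightarrow> V s \<omega> \<notin> A"
  shows "ennreal T \<le> hitting_time V A \<omega>"
  unfolding hitting_time_def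
proof (rule INF_greatest)
  fix t assume "t \<in> {t. 0 \<le> t \<and> V t \<omega> \<in> A}"
  then show "ennreal T \<le> ennreal t"
    using assms[of t] by (intro ennreal_leI) (cases "t \<le> T", auto)
qed

lemma inner_le_running_sup:
  "0 \<le> s \<Longrightarrow> s \<le> T \<Longrightarrow> ereal (u \<bullet> V s \<omega>) \<le> running_sup V u T \<omega>"
  unfolding running_sup_def by (rule SUP_upper2[where i = s]) (auto simp: inner_commute)

text \<open>At the infimum \<open>m\<close> of the visit times the path cannot lie in the open
  complement of \<open>A\<close>: right continuity would keep it there on some interval after
  \<open>m\<close>, so visits could not come arbitrarily close to \<open>m\<close>.\<close>

lemma hitting_time_attained:
  fixes V :: "real \<Rightarrow> 'w \<Rightarrow> 'b::t2_space"
  assumes A: "closed A"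
    and cont: "\<And>t. 0 \<le> t \<Longrightarrow> continuous (at_right t) (\<lambda>s. V s \<omega>)"
    and le: "hitting_time V A \<omega> \<le> ennreal T" and T: "0 \<le> T"
  shows "\<exists>s\<in>{0..T}. V s \<omega> \<in> A"
proof -
  define S where "S = {t. 0 \<le> t \<and> V t \<omega> \<in> A}"
  have bdd: "bdd_below S" by (rule bdd_belowI[of _ 0]) (auto simp: S_def)
  \<comment> \<open>The slack \<open>e\<close> is needed because an infimum of at most
    \<open>T\<close> only yields visits shortly after \<open>T\<close>, possibly none by
    \<open>T\<close> itself.\<close>
  have lt: "\<exists>s\<in>S. s < T + e" if "e > 0" for e
  proof -
    have "(INF t\<in>S. ennreal t) < ennreal (T + e)"
      using le that T unfolding hitting_time_def S_def
      by (elim le_less_trans) (simp add: ennreal_lessI)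
    then show ?thesis
      using T that by (auto simp: INF_less_iff S_def ennreal_less_iff simp del: ennreal_plus)
  qed
  then have ne: "S \<noteq> {}" by (metis empty_iff zero_less_one)
  define m where "m = Inf S"
  have m0: "0 \<le> m" unfolding m_def by (rule cInf_greatest[OF ne]) (auto simp: S_def)
  have mT: "m \<le> T"
  proof (rule field_le_epsilon)
    fix e :: real assume "e > 0"
    then obtain s where "s \<in> S" "s < T + e" using lt by blast
    then show "m \<le> T + e" using cInf_lower[OF _ bdd, of s] by (simp add: m_def)
  qed
  have "V m \<omega> \<in> A"
  proof (rule ccontr)
    assume notin: "V m \<omega> \<notin> A"
    have "((\<lambda>s. V s \<omega>) \<longlongrightarrow> V m \<omega>) (at_right m)"
      using cont[OF m0] by (simp add: continuous_within)
    then have "\<forall>\<^sub>F s in at_right m. V s \<omega> \<in> - A"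
      using A notin by (auto dest!: topological_tendstoD[where S = "- A"])
    then obtain b where b: "b > m" "\<And>s. m < s \<Longrightarrow> s < b \<Longrightarrow> V s \<omega> \<notin> A"
      by (auto simp: eventually_at_right_field)
    obtain s where s: "s \<in> S" "s < b"
      using cInf_lessD[OF ne, of b] b(1) by (auto simp: m_def)
    have "m \<le> s" unfolding m_def using cInf_lower[OF s(1) bdd] .
    \<comment> \<open>So \<open>s\<close> lies strictly between \<open>m\<close> and
      \<open>b\<close>, exactly where the path avoids \<open>A\<close>.\<close>
    moreover have "s \<noteq> m" using s(1) notin by (auto simp: S_def)
    ultimately show False using b(2)[of s] s by (auto simp: S_def)
  qed
  then show ?thesis using m0 mT by auto
qed

text \<open>The events that all \<open>f i\<close> stay below \<open>n\<close> increase with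
  \<open>n\<close>, and finiteness of \<open>I\<close> makes their union almost sure; continuity
  from below then pushes the probability past \<open>q\<close>.\<close>

lemma (in prob_space) ex_uniform_upper_bound:
  fixes f :: "'i \<Rightarrow> 'a \<Rightarrow> ereal"
  assumes I: "finite I" and [measurable]: "\<And>i. i \<in> I \<Longrightarrow> f i \<in> borel_measurable M"
    and fin: "\<And>i. i \<in> I \<Longrightarrow> AE \<omega> in M. f i \<omega> \<noteq> \<infinity>" and q: "q < 1"
  shows "\<exists>b::real. prob {\<omega> \<in> space M. \<forall>i\<in>I. f i \<omega> < ereal b} > q"
proof -
  define A where "A n = {\<omega> \<in> space M. \<forall>i\<in>I. f i \<omega> < ereal (real n)}" for n
  have [measurable]: "A n \<in> sets M" for n unfolding A_def using I by measurable
  have inc: "incseq A"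
    unfolding incseq_def A_def by (auto elim!: less_le_trans)
  have "AE \<omega> in M. \<forall>i\<in>I. f i \<omega> \<noteq> \<infinity>"
    using I fin by (simp add: AE_finite_all)
  then have "AE \<omega> in M. \<omega> \<in> (\<Union>n. A n)"
  proof (rule AE_mp, intro AE_I2 impI)
    fix \<omega> assume \<omega>: "\<omega> \<in> space M" and fin: "\<forall>i\<in>I. f i \<omega> \<noteq> \<infinity>"
    have "\<exists>n. f i \<omega> < ereal (real n)" if "i \<in> I" for i
      using fin that less_PInf_Ex_of_nat by blast
    then obtain n where n: "\<And>i. i \<in> I \<Longrightarrow> f i \<omega> < ereal (real (n i))" by metis
    \<comment> \<open>The sum stands in for the maximum of the \<open>n i\<close>; it also covers an
      empty \<open>I\<close>.\<close>
    have "f i \<omega> < ereal (real (\<Sum>i\<in>I. n i))" if "i \<in> I" for i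
      using n[OF that] member_le_sum[OF that, of n] I
      by (auto elim!: less_le_trans simp del: of_nat_sum)
    then show "\<omega> \<in> (\<Union>n. A n)" using \<omega> unfolding A_def by blast
  qed
  then have "prob (\<Union>n. A n) = 1" by (subst prob_eq_1) auto
  moreover have "(\<lambda>n. prob (A n)) \<longlonglongrightarrow> prob (\<Union>n. A n)"
    using inc by (intro finite_Lim_measure_incseq) auto
  ultimately have "\<forall>\<^sub>F n in sequentially. prob (A n) > q"
    using q by (intro order_tendstoD(1)) auto
  then obtain n where "prob (A n) > q" by (auto simp: eventually_sequentially)
  then show ?thesis unfolding A_def by blast
qed

text \<open>One event serves all directions: bounding the running suprema along the positive and
  negative coordinate axes bounds the norm of the path up to \<open>T\<close>, hence its inner
  product with every unit vector.\<close>

lemma ex_level_hitting_time_ge: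
  fixes V :: "real \<Rightarrow> 'w \<Rightarrow> real ^ 'd"
  assumes "prob_space M"
    and hit: "\<And>u b. u \<in> sphere 0 1 \<Longrightarrow>
      hitting_time V (upper_halfspace u b) \<in> borel_measurable M"
    and sup: "\<And>u. u \<in> sphere 0 1 \<Longrightarrow> running_sup V u T \<in> borel_measurable M"
    and fin: "\<And>u. u \<in> sphere 0 1 \<Longrightarrow> AE \<omega> in M. running_sup V u T \<omega> \<noteq> \<infinity>"
    and q: "q < 1"
  shows "\<exists>B. \<forall>u\<in>sphere 0 1. \<forall>b\<ge>B.
    measure M {\<omega> \<in> space M. hitting_time V (upper_halfspace u b) \<omega> \<ge> ennreal T} > q"
proof -
  interpret prob_space M by fact
  define I :: "(real ^ 'd) set" where "I = range (\<lambda>i. axis i 1) \<union> range (\<lambda>i. - axis i 1)"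
  have I: "finite I" "I \<subseteq> sphere 0 1" by (auto simp: I_def norm_axis_1)
  obtain c where c: "prob {\<omega> \<in> space M. \<forall>e\<in>I. running_sup V e T \<omega> < ereal c} > q"
    using ex_uniform_upper_bound[of I "\<lambda>e. running_sup V e T" q] I sup fin q by blast
  \<comment> \<open>If all coordinates are below \<open>c\<close> in absolute value, the l1 norm,
    and with it the Euclidean norm, is below \<open>B\<close>.\<close>
  define B where "B = real CARD('d) * c"
  have *: "ennreal T \<le> hitting_time V (upper_halfspace u b) \<omega>"
    if u: "u \<in> sphere 0 1" and b: "b \<ge> B" and \<omega>: "\<forall>e\<in>I. running_sup V e T \<omega> < ereal c" for u b \<omega>
  proof (rule hitting_time_geI)
    fix s assume s: "0 \<le> s" "s \<le> T"
    have lt: "e \<bullet> V s \<omega> < c" if "e \<in> I" for e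
      using le_less_trans[OF inner_le_running_sup[OF s]] \<omega> that by (metis less_ereal.simps(1))
    have abs: "\<bar>V s \<omega> $ i\<bar> < c" for i
      using lt[of "axis i 1"] lt[of "- axis i 1"]
      by (auto simp: I_def inner_axis' abs_less_iff)
    have "u \<bullet> V s \<omega> \<le> norm (V s \<omega>)"
      using norm_cauchy_schwarz[of u "V s \<omega>"] u by simp
    also have "\<dots> \<le> (\<Sum>i\<in>UNIV. \<bar>V s \<omega> $ i\<bar>)" by (rule norm_le_l1_cart)
    \<comment> \<open>Strictness matters: the half-space contains its boundary, and
      \<open>b = B\<close> is allowed.\<close>
    also have "\<dots> < (\<Sum>i\<in>(UNIV::'d set). c)" using abs by (intro sum_strict_mono) auto
    also have "\<dots> = B" by (simp add: B_def)
    finally show "V s \<omega> \<notin> upper_halfspace u b" using b by (simp add: upper_halfspace_def)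
  qed
  have "prob {\<omega> \<in> space M. hitting_time V (upper_halfspace u b) \<omega> \<ge> ennreal T} > q"
    if u: "u \<in> sphere 0 1" and b: "b \<ge> B" for u b
  proof -
    note [measurable] = hit[OF u, of b]
    have "prob {\<omega> \<in> space M. \<forall>e\<in>I. running_sup V e T \<omega> < ereal c}
        \<le> prob {\<omega> \<in> space M. hitting_time V (upper_halfspace u b) \<omega> \<ge> ennreal T}"
      using *[OF u b] by (intro finite_measure_mono) auto
    then show ?thesis using c by simp
  qed
  then show ?thesis by blast
qed

lemma Inf_ereal_image_le:
  "b \<in> S \<Longrightarrow> b \<le> B \<Longrightarrow> Inf (ereal ` S) \<le> ereal B"
  by (rule Inf_lower2[of "ereal b"]) auto

text \<open>Without atoms the distribution function is continuous; its limits are 0 and 1, so the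
  intermediate value theorem applies.\<close>

lemma (in prob_space) ex_cdf_value:
  fixes X :: "'a \<Rightarrow> real"
  assumes X[measurable]: "X \<in> borel_measurable M"
    and atomless: "\<And>x. prob {\<omega> \<in> space M. X \<omega> = x} = 0"
    and q: "0 < q" "q < 1"
  shows "\<exists>b. prob {\<omega> \<in> space M. X \<omega> \<le> b} = q"
proof -
  interpret D: real_distribution "distr M borel X" by (rule real_distribution_distr) simp
  have cdf: "cdf (distr M borel X) b = prob {\<omega> \<in> space M. X \<omega> \<le> b}" for b
    by (simp add: cdf_def measure_distr vimage_def Int_def conj_commute)
  have cont: "isCont (cdf (distr M borel X)) x" for x
    using atomless[of x]
    by (simp add: D.isCont_cdf measure_distr vimage_def Int_def conj_commute)
  obtain a where a: "cdf (distr M borel X) a < q"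
    using order_tendstoD(2)[OF D.cdf_lim_at_bot q(1)] by (auto simp: eventually_at_bot_linorder)
  obtain c where c: "cdf (distr M borel X) c > q"
    using order_tendstoD(1)[OF D.cdf_lim_at_top_prob q(2)] by (auto simp: eventually_at_top_linorder)
  have "a \<le> c" using a c D.cdf_nondecreasing[of c a] by linarith
  then show ?thesis using IVT[of "cdf (distr M borel X)" a q c] a c cont by (auto simp: cdf)
qed

text \<open>Up to a null set, surviving past \<open>ts\<close> means that the running supremum at
  \<open>ts\<close> is at most \<open>b\<close>, so a level is found among the values of an atomless
  distribution function.\<close>

lemma C_Q_levels_nonempty:
  fixes V :: "real \<Rightarrow> 'w \<Rightarrow> real ^ 'd"
  assumes "prob_space M"
    and hit: "\<And>b. hitting_time V (upper_halfspace u b) \<in> borel_measurable M"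
    and [measurable]: "running_sup V u ts \<in> borel_measurable M"
    and ts: "0 < ts" and q: "0 < qs" "qs < 1"
    and atomless: "\<And>b. measure M {\<omega> \<in> space M. running_sup V u ts \<omega> = b} = 0"
    and rc: "right_continuous_paths M V"
  shows "C_Q_levels M V ts qs u \<noteq> {}"
proof -
  interpret prob_space M by fact
  \<comment> \<open>Infinite values become 0 here, but only on a null set, since there are no atoms
    at plus or minus infinity.\<close>
  define X where "X \<omega> = real_of_ereal (running_sup V u ts \<omega>)" for \<omega>
  have [measurable]: "X \<in> borel_measurable M" unfolding X_def by measurable
  have ne: "AE \<omega> in M. running_sup V u ts \<omega> \<noteq> b" for b
    using atomless[of b] by (simp add: prob_Collect_eq_0)
  have fin: "AE \<omega> in M. running_sup V u ts \<omega> = ereal (X \<omega>)"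
    using ne[of \<infinity>] ne[of "-\<infinity>"] by eventually_elim (auto simp: X_def ereal_real)
  have neX: "AE \<omega> in M. X \<omega> \<noteq> x" for x
    using ne[of "ereal x"] fin by eventually_elim auto
  have "prob {\<omega> \<in> space M. X \<omega> = x} = 0" for x
    using neX[of x] by (simp add: prob_Collect_eq_0)
  then obtain b where b: "prob {\<omega> \<in> space M. X \<omega> \<le> b} = qs"
    using ex_cdf_value[of X qs] q by auto
  note [measurable] = hit[of b]
  \<comment> \<open>The case \<open>X \<omega> = b\<close> is excluded as a null event: a supremum
    equal to \<open>b\<close> does not decide whether the level is reached by time
    \<open>ts\<close>.\<close>
  have "AE \<omega> in M. hitting_time V (upper_halfspace u b) \<omega> > ennreal ts \<longleftrightarrow> X \<omega> \<le> b"
    using fin neX[of b] rc[unfolded right_continuous_paths_def]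
  proof eventually_elim
    case (elim \<omega>)
    have eq: "running_sup V u ts \<omega> = ereal (X \<omega>)" and neq: "X \<omega> \<noteq> b" using elim by auto
    have attained: "\<exists>s\<in>{0..ts}. V s \<omega> \<in> upper_halfspace u b"
      if "hitting_time V (upper_halfspace u b) \<omega> \<le> ennreal ts"
      using elim that ts
      by (intro hitting_time_attained) (auto simp: upper_halfspace_def closed_halfspace_ge)
    show ?case
    proof
      assume gt: "hitting_time V (upper_halfspace u b) \<omega> > ennreal ts"
      have "running_sup V u ts \<omega> \<le> ereal b"
        unfolding running_sup_def
      proof (rule SUP_least)
        fix s assume s: "s \<in> {0..ts}"
        have "V s \<omega> \<notin> upper_halfspace u b"
        proof
          assume "V s \<omega> \<in> upper_halfspace u b"
          then have "hitting_time V (upper_halfspace u b) \<omega> \<le> ennreal s"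
            unfolding hitting_time_def using s by (intro INF_lower) auto
          also have "\<dots> \<le> ennreal ts" using s by (intro ennreal_leI) auto
          finally show False using gt by simp
        qed
        then show "ereal (V s \<omega> \<bullet> u) \<le> ereal b"
          by (simp add: upper_halfspace_def inner_commute)
      qed
      then show "X \<omega> \<le> b" by (simp add: eq)
    next
      assume "X \<omega> \<le> b"
      then have "X \<omega> < b" using neq by simp
      show "hitting_time V (upper_halfspace u b) \<omega> > ennreal ts"
      \<comment> \<open>Right continuity enters here: a hitting time of at most \<open>ts\<close> is
        attained, which forces the supremum up to \<open>b\<close>.\<close>
      proof (rule ccontr)
        assume "\<not> ?thesis"
        then obtain s where s: "0 \<le> s" "s \<le> ts" "b \<le> u \<bullet> V s \<omega>"
          using attained by (force simp: upper_halfspace_def not_less)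
        then show False
          using inner_le_running_sup[OF s(1,2), of u V \<omega>] \<open>X \<omega> < b\<close> by (simp add: eq)
      qed
    qed
  qed
  then have "prob {\<omega> \<in> space M. hitting_time V (upper_halfspace u b) \<omega> > ennreal ts} = qs"
    unfolding b[symmetric] by (intro finite_measure_eq_AE) auto
  then show ?thesis unfolding C_Q_levels_def by blast
qed

text \<open>In a direction without levels \<open>C_Q\<close> is infinite. Its bound is therefore
  stated over the directions where it is well defined and, for right-continuous paths, over the
  whole sphere.\<close>

theorem lemma5p9:
  fixes M :: "'w measure"
    and F :: "real \<Rightarrow> 'w measure"
    and V :: "real \<Rightarrow> 'w \<Rightarrow> real ^ 'd"
    and tr ts qs :: real
  assumes "prob_space M"
    and "filtration (space M) F"
    and "\<And>t. t \<ge> 0 \<Longrightarrow> subalgebra M (F t)"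
    and "progressively_measurable F V"
    and "\<And>u b. u \<in> sphere 0 1 \<Longrightarrow>
           hitting_time V (upper_halfspace u b) \<in> borel_measurable M"
    and "\<And>u t. u \<in> sphere 0 1 \<Longrightarrow> t > 0 \<Longrightarrow> running_sup V u t \<in> borel_measurable M"
    and "tr > 0" and "ts > 0" and "0 < qs" and "qs < 1"
    and "\<And>u. u \<in> sphere 0 1 \<Longrightarrow> C_T_well_defined M V tr u"
    and "\<And>u t (b::ereal). u \<in> sphere 0 1 \<Longrightarrow> t > 0 \<Longrightarrow>
           measure M {\<omega> \<in> space M. running_sup V u t \<omega> = b} = 0"
  shows "bounded_from_above_on (sphere 0 1) (C_T M V tr)
    \<and> bounded_from_above_on {u \<in> sphere 0 1. C_Q_well_defined M V ts qs u} (C_Q M V ts qs)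
    \<and> (right_continuous_paths M V \<longrightarrow> bounded_from_above_on (sphere 0 1) (C_Q M V ts qs))"
proof -
  interpret prob_space M by fact
  note hit = assms(5) and sup = assms(6) and wd = assms(11) and atomless = assms(12)
  have fin: "AE \<omega> in M. running_sup V u t \<omega> \<noteq> \<infinity>" if "u \<in> sphere 0 1" "t > 0" for u t
  proof -
    note [measurable] = sup[OF that]
    show ?thesis using atomless[OF that, of \<infinity>] by (simp add: prob_Collect_eq_0)
  qed
  note level = ex_level_hitting_time_ge[OF \<open>prob_space M\<close> hit sup fin]

  \<comment> \<open>The constants are chosen for Markov's inequality: time \<open>2 * tr\<close>
    with probability above \<open>1/2\<close> makes the expectation exceed
    \<open>tr\<close>.\<close>
  obtain BT where BT: "\<And>u b. u \<in> sphere 0 1 \<Longrightarrow> b \<ge> BT \<Longrightarrow>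
      prob {\<omega> \<in> space M. hitting_time V (upper_halfspace u b) \<omega> \<ge> ennreal (2 * tr)} > 1/2"
    using level[of "2 * tr" "1/2"] \<open>tr > 0\<close> by fastforce
  have T_le: "b \<le> BT" if u: "u \<in> sphere 0 1" and b: "b \<in> C_T_levels M V tr u" for u b
  proof (rule ccontr)
    assume "\<not> b \<le> BT"
    define A where "A = {\<omega> \<in> space M. hitting_time V (upper_halfspace u b) \<omega> \<ge> ennreal (2 * tr)}"
    note [measurable] = hit[OF u, of b]
    have [measurable]: "A \<in> sets M" unfolding A_def by measurable
    have "prob A > 1/2" using BT[OF u, of b] \<open>\<not> b \<le> BT\<close> by (simp add: A_def)
    then have "ennreal tr < ennreal (2 * tr * prob A)"
      using \<open>tr > 0\<close> by (intro ennreal_lessI) auto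
    also have "\<dots> = (\<integral>\<^sup>+ \<omega>. ennreal (2 * tr) * indicator A \<omega> \<partial>M)"
      using \<open>tr > 0\<close> by (simp add: nn_integral_cmult_indicator emeasure_eq_measure ennreal_mult)
    also have "\<dots> \<le> (\<integral>\<^sup>+ \<omega>. hitting_time V (upper_halfspace u b) \<omega> \<partial>M)"
      by (intro nn_integral_mono) (auto simp: A_def indicator_def)
    also have "\<dots> = ennreal tr" using b by (simp add: C_T_levels_def)
    finally show False by simp
  qed
  \<comment> \<open>Well-definedness supplies a level; a bound on all levels says nothing about the
    infimum of an empty set, which is \<open>\<infinity>\<close>.\<close>
  have T: "C_T M V tr u \<le> ereal BT" if "u \<in> sphere 0 1" for u
    using wd[OF that] T_le[OF that]
    by (auto simp: C_T_well_defined_def C_T_def intro: Inf_ereal_image_le)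

  \<comment> \<open>The horizon \<open>ts + 1\<close> turns the non-strict bound on the hitting time
    into the strict one in the survival probability.\<close>
  obtain BQ where BQ: "\<And>u b. u \<in> sphere 0 1 \<Longrightarrow> b \<ge> BQ \<Longrightarrow>
      prob {\<omega> \<in> space M. hitting_time V (upper_halfspace u b) \<omega> \<ge> ennreal (ts + 1)} > qs"
    using level[of "ts + 1" qs] \<open>ts > 0\<close> \<open>qs < 1\<close> by fastforce
  have Q_le: "b \<le> BQ" if u: "u \<in> sphere 0 1" and b: "b \<in> C_Q_levels M V ts qs u" for u b
  proof (rule ccontr)
    assume "\<not> b \<le> BQ"
    note [measurable] = hit[OF u, of b]
    have "qs < prob {\<omega> \<in> space M. hitting_time V (upper_halfspace u b) \<omega> \<ge> ennreal (ts + 1)}"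
      using BQ[OF u, of b] \<open>\<not> b \<le> BQ\<close> by simp
    also have "\<dots> \<le> prob {\<omega> \<in> space M. hitting_time V (upper_halfspace u b) \<omega> > ennreal ts}"
      using \<open>ts > 0\<close>
      by (intro finite_measure_mono) (auto elim!: less_le_trans[rotated] intro!: ennreal_lessI)
    also have "\<dots> = qs" using b by (simp add: C_Q_levels_def)
    finally show False by simp
  qed
  have Q: "C_Q M V ts qs u \<le> ereal BQ"
    if "u \<in> sphere 0 1" "C_Q_levels M V ts qs u \<noteq> {}" for u
    using that(2) Q_le[OF that(1)] by (auto simp: C_Q_def intro: Inf_ereal_image_le)

  have "C_Q_levels M V ts qs u \<noteq> {}" if "right_continuous_paths M V" "u \<in> sphere 0 1" for u
    using that(1) \<open>ts > 0\<close> \<open>0 < qs\<close> \<open>qs < 1\<close>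
    by (intro C_Q_levels_nonempty[OF \<open>prob_space M\<close>] hit sup atomless that(2)) auto
  then show ?thesis
    using T Q unfolding bounded_from_above_on_def C_Q_well_defined_def by blast
qed

end
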